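(* Let $A(E_6)$ be the Cartan matrix of the root system $E_6$ (Bourbaki numbering) $$A(E_6) = \begin{pmatrix} 2 & 0 & -1 & 0 & 0 & 0 \\ 0 & 2 & 0 & -1 & 0 & 0 \\ -1 & 0 & 2 & -1 & 0 & 0 \\ 0 & -1 & -1 & 2 & -1 & 0 \\ 0 & 0 & 0 & -1 & 2 & -1 \\ 0 & 0 & 0 & 0 & -1 & 2 \end{pmatrix}.$$ Let $\delta = \frac{\pi}{2}$, and for integers $1\le a\le 3$, $1\le b\le 2$ let $\theta = \frac{a\pi}{4}$, $\gamma = \frac{b\pi}{3}$ and $\alpha = \theta+\gamma+\delta$. Then the $6$ eigenvalues of $A(E_6)$ are the numbers $$\lambda(\theta,\gamma) = 2 - 2\cos\alpha$$ for the $6$ pairs $(a,b)$, and for each such pair the vector $$X_{E_6}(\theta,\gamma) = \begin{pmatrix} \cos (3\gamma + 3 \theta - \delta ) \\ 2 \cos^{2} \theta \\ -2 \cos ( 3 \gamma + 3 \theta - \delta) \cos (\gamma + \theta - \delta) \\ -4 \cos^{2} \theta\, \cos ( \gamma + \theta - \delta) \\ 1 - 2 \cos ( 2 \gamma + 3 \theta) \cos \theta \\ -2 \cos(\gamma) \cos (\theta - \delta) \end{pmatrix}$$ is an eigenvector of $A(E_6)$ with eigenvalue $\lambda(\theta,\gamma)$.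
   Context: The matrix acts on column vectors. An eigenvector is by definition nonzero. *)

theory Defs
  imports "Jordan_Normal_Form.Spectral_Radius"
begin

definition cartan_E6 :: "real mat" where
  "cartan_E6 = mat_of_rows_list 6
    [[ 2,  0, -1,  0,  0,  0],
     [ 0,  2,  0, -1,  0,  0],
     [-1,  0,  2, -1,  0,  0],
     [ 0, -1, -1,  2, -1,  0],
     [ 0,  0,  0, -1,  2, -1],
     [ 0,  0,  0,  0, -1,  2]]"

definition delta_E6 :: real where
  "delta_E6 = pi / 2"

definition lambda_E6 :: "real \<Rightarrow> real \<Rightarrow> real" where
  "lambda_E6 \<theta> \<gamma> = (let \<alpha> = \<theta> + \<gamma> + delta_E6 in 2 - 2 * cos \<alpha>)"

definition X_E6 :: "real \<Rightarrow> real \<Rightarrow> real vec" where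
  "X_E6 \<theta> \<gamma> = (let \<delta> = delta_E6 in vec_of_list
    [cos (3 * \<gamma> + 3 * \<theta> - \<delta>),
     2 * (cos \<theta>)\<^sup>2,
     - 2 * cos (3 * \<gamma> + 3 * \<theta> - \<delta>) * cos (\<gamma> + \<theta> - \<delta>),
     - 4 * (cos \<theta>)\<^sup>2 * cos (\<gamma> + \<theta> - \<delta>),
     1 - 2 * cos (2 * \<gamma> + 3 * \<theta>) * cos \<theta>,
     - 2 * cos \<gamma> * cos (\<theta> - \<delta>)])"

definition theta_E6 :: "int \<Rightarrow> real" where
  "theta_E6 a = of_int a * pi / 4"

definition gamma_E6 :: "int \<Rightarrow> real" where
  "gamma_E6 b = of_int b * pi / 3"

end

(*
  Write c, s, C, S for cos gamma, sin gamma, cos theta, sin theta. The angles enter the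
  eigenvector equations only through 4 c^2 = 1, 4 s^2 = 3, C^2 + S^2 = 1 and
  C (2 C^2 - 1) = 0, modulo which the equations are polynomial identities. The angles alpha
  are distinct and lie in [pi, 2 pi], where cos is injective, so the six eigenvalues are
  distinct and exhaust the spectrum of a 6 x 6 matrix.
*)
theory Submission
  imports Defs
begin

lemma cartan_E6_carrier: "cartan_E6 \<in> carrier_mat 6 6"
  by (simp add: cartan_E6_def mat_of_rows_list_def carrier_matI)

lemma cartan_E6_mult_vec:
  "cartan_E6 *\<^sub>v vec_of_list [x1, x2, x3, x4, x5, x6] =
    vec_of_list [2 * x1 - x3, 2 * x2 - x4, 2 * x3 - x1 - x4,
      2 * x4 - x2 - x3 - x5, 2 * x5 - x4 - x6, 2 * x6 - x5]"
  (is "?l = ?r")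
proof (rule eq_vecI)
  fix i assume "i < dim_vec ?r"
  then have "i \<in> {0, 1, 2, 3, 4, 5}" by auto
  then show "?l $ i = ?r $ i"
    by (auto simp: cartan_E6_def mat_of_rows_list_def scalar_prod_def row_def
        numeral_eq_Suc vec_of_list_index)
qed (simp add: cartan_E6_def mat_of_rows_list_def)

text \<open>The hypotheses say cos \<theta> = 0 or cos (2 \<theta>) = 0, and cos \<gamma> = 1/2 or
  -1/2, which covers all six pairs at once. The third and fourth entries of the vector are -2 sin
  (\<theta> + \<gamma>) times the first and second, so the first two rows hold for arbitrary
  angles.\<close>

lemma eigenvector_cartan_E6:
  assumes C: "cos \<theta> * (2 * (cos \<theta>)\<^sup>2 - 1) = 0" and c: "4 * (cos \<gamma>)\<^sup>2 = 1"
  shows "eigenvector cartan_E6 (X_E6 \<theta> \<gamma>) (lambda_E6 \<theta> \<gamma>)"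
proof -
  have S: "(sin \<theta>)\<^sup>2 + (cos \<theta>)\<^sup>2 = 1" by simp
  have s: "4 * (sin \<gamma>)\<^sup>2 = 3" using c sin_cos_squared_add[of \<gamma>] by linarith
  define \<sigma> where "\<sigma> = sin \<theta> * cos \<gamma> + cos \<theta> * sin \<gamma>"
  define t where "t = sin (3 * (\<theta> + \<gamma>))"
  define u where "u = cos (2 * \<gamma> + 3 * \<theta>)"
  have \<sigma>: "sin (\<theta> + \<gamma>) = \<sigma>" by (simp add: \<sigma>_def sin_add)
  have cos3: "cos (3 * \<gamma>) = - 3 * cos \<gamma> + 4 * (cos \<gamma>)^3"
    and sin3: "sin (3 * \<gamma>) = 3 * sin \<gamma> - 4 * (sin \<gamma>)^3" for \<gamma> :: real
  proof -
    show cos3: "cos (3 * \<gamma>) = - 3 * cos \<gamma> + 4 * (cos \<gamma>)^3" for \<gamma> :: real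
      using cos_treble_cos[of \<gamma>] by simp
    \<comment> \<open>The sine formula is the cosine one at the complementary angle, since cos (3 pi
      / 2 - x) = - sin x.\<close>
    have "sin (3 * \<gamma>) = - cos (3 * (pi / 2 - \<gamma>))"
      using cos_periodic_pi[of "pi / 2 - 3 * \<gamma>"] by (simp add: cos_diff algebra_simps)
    then show "sin (3 * \<gamma>) = 3 * sin \<gamma> - 4 * (sin \<gamma>)^3"
      unfolding cos3 by (simp add: cos_diff)
  qed
  have t: "t = 3 * \<sigma> - 4 * \<sigma>^3"
    unfolding t_def sin3 \<sigma> ..
  have u: "u = ((cos \<gamma>)\<^sup>2 - (sin \<gamma>)\<^sup>2) * (- 3 * cos \<theta> + 4 * (cos \<theta>)^3)
      - 2 * sin \<gamma> * cos \<gamma> * (3 * sin \<theta> - 4 * (sin \<theta>)^3)"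
    unfolding u_def cos_add cos3 sin3 cos_double sin_double ..
  have X: "X_E6 \<theta> \<gamma> = vec_of_list [t, 2 * (cos \<theta>)\<^sup>2, - 2 * t * \<sigma>, - 4 * (cos \<theta>)\<^sup>2 * \<sigma>,
      1 - 2 * u * cos \<theta>, - 2 * cos \<gamma> * sin \<theta>]"
  proof -
    have "cos (3 * \<gamma> + 3 * \<theta> - pi / 2) = t"
      unfolding t_def by (simp add: cos_diff algebra_simps)
    moreover have "cos (\<gamma> + \<theta> - pi / 2) = \<sigma>"
      unfolding \<sigma>[symmetric] by (simp add: cos_diff algebra_simps)
    moreover have "cos (\<theta> - pi / 2) = sin \<theta>" by (simp add: cos_diff)
    ultimately show ?thesis
      unfolding X_E6_def delta_E6_def Let_def u_def by simp
  qed
  have l: "lambda_E6 \<theta> \<gamma> = 2 + 2 * \<sigma>"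
    by (simp add: lambda_E6_def delta_E6_def cos_add[of "\<theta> + \<gamma>"] \<sigma>)
  \<comment> \<open>In each case all squares of sines and cosines become rational constants, so
    rewriting can decide the remaining identities.\<close>
  from C consider (zero) "cos \<theta> = 0" "sin \<theta> * sin \<theta> = 1"
    | (half) "cos \<theta> * cos \<theta> = 1 / 2" "sin \<theta> * sin \<theta> = 1 / 2"
    using S by (auto simp: power2_eq_square)
  note cases = this
  have cc: "cos \<gamma> * cos \<gamma> = 1 / 4" and ss: "sin \<gamma> * sin \<gamma> = 3 / 4"
    using c s by (simp_all add: power2_eq_square)
  \<comment> \<open>Expanded products are nested to the right, so a square may occur only as x * (x
    * y), where the rule for x * x does not match.\<close>
  have absorb: "x * (x * y) = r * y" if "x * x = r" for x y r :: real
    using that by (simp flip: mult.assoc)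
  \<comment> \<open>These are rows three to six of (A - 2) X = 2 \<sigma> X, with A the Cartan
    matrix and X the vector.\<close>
  have r3: "- t + 4 * (cos \<theta>)\<^sup>2 * \<sigma> = - 4 * t * \<sigma>\<^sup>2" (is ?r3)
    and r4: "- 2 * (cos \<theta>)\<^sup>2 + 2 * t * \<sigma> - (1 - 2 * u * cos \<theta>) = - 8 * (cos \<theta>)\<^sup>2 * \<sigma>\<^sup>2" (is ?r4)
    and r5: "4 * (cos \<theta>)\<^sup>2 * \<sigma> + 2 * cos \<gamma> * sin \<theta> = 2 * \<sigma> * (1 - 2 * u * cos \<theta>)" (is ?r5)
    and r6: "- (1 - 2 * u * cos \<theta>) = - 4 * \<sigma> * cos \<gamma> * sin \<theta>" (is ?r6)
  proof -
    note reduce = cc ss absorb[OF cc] absorb[OF ss] t u \<sigma>_def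
      power2_eq_square power3_eq_cube algebra_simps
    have "?r3 \<and> ?r4 \<and> ?r5 \<and> ?r6"
      using cases
    proof cases
      case zero
      note z = zero absorb[OF zero(2)]
      show ?thesis by (intro conjI; simp add: z reduce)
    next
      case half
      note z = half absorb[OF half(1)] absorb[OF half(2)]
      show ?thesis by (intro conjI; simp add: z reduce)
    qed
    then show ?r3 ?r4 ?r5 ?r6 by blast+
  qed
  have eq: "cartan_E6 *\<^sub>v X_E6 \<theta> \<gamma> = lambda_E6 \<theta> \<gamma> \<cdot>\<^sub>v X_E6 \<theta> \<gamma>"
    (is "?l = ?r")
  proof (rule eq_vecI)
    fix i assume "i < dim_vec ?r"
    then have "i \<in> {0, 1, 2, 3, 4, 5}" by (auto simp: X)
    then show "?l $ i = ?r $ i"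
      unfolding X l cartan_E6_mult_vec
      using r3 r4 r5 r6
      by (auto simp: numeral_eq_Suc vec_of_list_index) (simp_all add: algebra_simps power2_eq_square)
  qed (simp add: X carrier_matD[OF cartan_E6_carrier])
  have "X_E6 \<theta> \<gamma> \<noteq> 0\<^sub>v 6"
  proof
    assume "X_E6 \<theta> \<gamma> = 0\<^sub>v 6"
    \<comment> \<open>Counting from 0, these are the second and sixth entries. As cos \<gamma> is
      nonzero, their vanishing forces cos \<theta> = sin \<theta> = 0.\<close>
    then have "X_E6 \<theta> \<gamma> $ 1 = 0" "X_E6 \<theta> \<gamma> $ 5 = 0" by simp_all
    then have "cos \<theta> = 0" "cos \<gamma> * sin \<theta> = 0"
      by (auto simp: X numeral_eq_Suc vec_of_list_index)
    with c S show False by auto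
  qed
  with eq show ?thesis
    using cartan_E6_carrier by (simp add: eigenvector_def X carrier_vecI)
qed

lemma inj_on_lambda_E6:
  "inj_on (\<lambda>(a, b). lambda_E6 (theta_E6 a) (gamma_E6 b)) ({1..3} \<times> {1..2})"
proof -
  have "a = a' \<and> b = b'"
    if ab: "a \<in> {1..3}" "b \<in> {1..2}" "a' \<in> {1..3}" "b' \<in> {1..2}"
      and eq: "lambda_E6 (theta_E6 a) (gamma_E6 b) = lambda_E6 (theta_E6 a') (gamma_E6 b')"
    for a b a' b'
  proof -
    \<comment> \<open>\<open>f a b\<close> is 2 pi - \<alpha> in units of pi / 12: the reflection
      keeps the cosine and moves the angle into [0, pi], where \<open>cos_inj_pi\<close>
      applies.\<close>
    define f where "f a b = real_of_int (18 - 3 * a - 4 * b) * (pi / 12)" for a b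
    have lam: "lambda_E6 (theta_E6 a) (gamma_E6 b) = 2 - 2 * cos (f a b)" for a b
    proof -
      have "theta_E6 a + gamma_E6 b + delta_E6 = 2 * pi - f a b"
        by (simp add: f_def theta_E6_def gamma_E6_def delta_E6_def field_simps)
      then show ?thesis by (simp add: lambda_E6_def Let_def)
    qed
    have bnd: "0 \<le> f a b \<and> f a b \<le> pi" if "a \<in> {1..3}" "b \<in> {1..2}" for a b
    proof -
      have "0 \<le> 18 - 3 * a - 4 * b" "18 - 3 * a - 4 * b \<le> 12" using that by auto
      then have "0 \<le> real_of_int (18 - 3 * a - 4 * b)" "real_of_int (18 - 3 * a - 4 * b) \<le> 12"
        by linarith+
      then show ?thesis unfolding f_def
        using mult_right_mono[of "real_of_int (18 - 3 * a - 4 * b)" 12 "pi / 12"] by simp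
    qed
    have "cos (f a b) = cos (f a' b')" using eq by (simp add: lam)
    then have "f a b = f a' b'" using bnd ab cos_inj_pi by blast
    then have "18 - 3 * a - 4 * b = 18 - 3 * a' - 4 * b'" by (simp add: f_def del: of_int_diff)
    \<comment> \<open>From 3a + 4b = 3a' + 4b' it follows that 4 divides a - a', hence a = a' in
      this range; checking the finitely many cases confirms it.\<close>
    moreover have "a = 1 \<or> a = 2 \<or> a = 3" "a' = 1 \<or> a' = 2 \<or> a' = 3"
      "b = 1 \<or> b = 2" "b' = 1 \<or> b' = 2" using ab by auto
    ultimately show ?thesis by (elim disjE) simp_all
  qed
  then show ?thesis unfolding inj_on_def by auto
qed

theorem mainTheorem2:
  shows "bij_betw (\<lambda>(a, b). lambda_E6 (theta_E6 a) (gamma_E6 b))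
           ({1..3} \<times> {1..2}) (spectrum cartan_E6) \<and>
         (\<forall>a\<in>{1..3}. \<forall>b\<in>{1..2}.
           eigenvector cartan_E6 (X_E6 (theta_E6 a) (gamma_E6 b))
             (lambda_E6 (theta_E6 a) (gamma_E6 b)))"
proof -
  have C: "cos (theta_E6 a) * (2 * (cos (theta_E6 a))\<^sup>2 - 1) = 0" if "a \<in> {1..3}" for a
  proof -
    from that have "a \<in> {1, 2, 3}" by auto
    moreover have "cos (3 * pi / 4) = - (sqrt 2 / 2)"
      using cos_pi_minus[of "pi / 4"] by (simp add: cos_45)
    ultimately show ?thesis by (auto simp: theta_E6_def cos_45 power_divide)
  qed
  have c: "4 * (cos (gamma_E6 b))\<^sup>2 = 1" if "b \<in> {1..2}" for b
  proof -
    from that have "b \<in> {1, 2}" by auto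
    then show ?thesis by (auto simp: gamma_E6_def cos_60 cos_120 power_divide)
  qed
  have ev: "eigenvector cartan_E6 (X_E6 (theta_E6 a) (gamma_E6 b))
      (lambda_E6 (theta_E6 a) (gamma_E6 b))" if "a \<in> {1..3}" "b \<in> {1..2}" for a b
    using eigenvector_cartan_E6[OF C[OF that(1)] c[OF that(2)]] .
  let ?f = "\<lambda>(a, b). lambda_E6 (theta_E6 a) (gamma_E6 b)"
  have "?f ` ({1..3} \<times> {1..2}) = spectrum cartan_E6"
  \<comment> \<open>The image has six elements by injectivity, and a 6 x 6 matrix has at most six
    eigenvalues, so inclusion gives equality.\<close>
  proof (rule card_seteq)
    show "finite (spectrum cartan_E6)" using card_finite_spectrum[OF cartan_E6_carrier] by simp
    show "?f ` ({1..3} \<times> {1..2}) \<subseteq> spectrum cartan_E6"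
      unfolding spectrum_def eigenvalue_def using ev by fast
    show "card (spectrum cartan_E6) \<le> card (?f ` ({1..3} \<times> {1..2}))"
      using card_finite_spectrum[OF cartan_E6_carrier]
      by (simp add: card_image[OF inj_on_lambda_E6] card_cartesian_product)
  qed
  with inj_on_lambda_E6 ev show ?thesis by (auto simp: bij_betw_def)
qed

end
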